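(* Let $C=(C_{i,j})$ and $D=(D_{i,j})$ be $n\times n$ matrices with strictly positive entries, and let $A$ be their entrywise product, $A_{i,j}=C_{i,j}D_{i,j}$. Let $\Omega_n$ denote the set of $n\times n$ doubly stochastic matrices (non-negative entries, all row and column sums equal to $1$). Define the $n^2$-variate polynomials $p(x)=\prod_{i=1}^n\sum_{j=1}^n x_{i,j}C_{i,j}$ and $q(y)=\prod_{j=1}^n\sum_{i=1}^n y_{i,j}D_{i,j}$, and $$R_P(A)=\sup_{B\in\Omega_n}\ \inf_{x,y\in\mathbb{R}^{n\times n}_{>0}}\frac{p(x)\,q(y)\prod_{i,j}B_{i,j}^{B_{i,j}}}{\prod_{i,j}(x_{i,j}y_{i,j})^{B_{i,j}}},$$ and $$R_E(A)=\sup_{B\in\Omega_n}\sum_{i,j=1}^n B_{i,j}\log\frac{A_{i,j}}{B_{i,j}},$$ with conventions $0^0=1$ and $0\log\frac{a}{0}=0$. Then $R_P(A)=\exp(R_E(A))$. *)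

theory Defs
  imports "HOL-Analysis.Analysis"
begin

definition positive_matrices :: "(real ^ 'n ^ 'n) set" where
  "positive_matrices = {M. \<forall>i j. M $ i $ j > 0}"

definition doubly_stochastic :: "(real ^ 'n ^ 'n) set" where
  "doubly_stochastic =
     {B. (\<forall>i j. B $ i $ j \<ge> 0) \<and>
         (\<forall>i. (\<Sum>j\<in>UNIV. B $ i $ j) = 1) \<and>
         (\<forall>j. (\<Sum>i\<in>UNIV. B $ i $ j) = 1)}"

definition entrywise_product :: "real ^ 'n ^ 'n \<Rightarrow> real ^ 'n ^ 'n \<Rightarrow> real ^ 'n ^ 'n" where
  "entrywise_product C D = (\<chi> i j. C $ i $ j * D $ i $ j)"

definition row_poly :: "real ^ 'n ^ 'n \<Rightarrow> real ^ 'n ^ 'n \<Rightarrow> real" where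
  "row_poly C x = (\<Prod>i\<in>UNIV. \<Sum>j\<in>UNIV. x $ i $ j * C $ i $ j)"

definition col_poly :: "real ^ 'n ^ 'n \<Rightarrow> real ^ 'n ^ 'n \<Rightarrow> real" where
  "col_poly D y = (\<Prod>j\<in>UNIV. \<Sum>i\<in>UNIV. y $ i $ j * D $ i $ j)"

text \<open>In the library \<open>0 powr 0 = 0\<close>, whereas the convention needed for the entries
  of a doubly stochastic matrix is \<open>0\<^sup>0 = 1\<close>.\<close>

definition self_power :: "real \<Rightarrow> real" where
  "self_power b = (if b = 0 then 1 else b powr b)"

definition RP_objective ::
    "real ^ 'n ^ 'n \<Rightarrow> real ^ 'n ^ 'n \<Rightarrow> real ^ 'n ^ 'n \<Rightarrow> real ^ 'n ^ 'n \<Rightarrow> real ^ 'n ^ 'n \<Rightarrow> real" where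
  "RP_objective C D B x y =
     row_poly C x * col_poly D y * (\<Prod>i\<in>UNIV. \<Prod>j\<in>UNIV. self_power (B $ i $ j)) /
     (\<Prod>i\<in>UNIV. \<Prod>j\<in>UNIV. (x $ i $ j * y $ i $ j) powr (B $ i $ j))"

text \<open>The quantity \<open>R\<^sub>P(A)\<close> is defined through a factorisation
  \<open>A = entrywise_product C D\<close>, so it takes the two factors as arguments.\<close>

definition R_P :: "real ^ 'n ^ 'n \<Rightarrow> real ^ 'n ^ 'n \<Rightarrow> real" where
  "R_P C D =
     (SUP B\<in>doubly_stochastic.
        INF (x, y)\<in>positive_matrices \<times> positive_matrices. RP_objective C D B x y)"

text \<open>For \<open>B $ i $ j = 0\<close> the summand is \<open>0\<close>, as the convention
  \<open>0 log (a / 0) = 0\<close> demands.\<close>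

definition RE_objective :: "real ^ 'n ^ 'n \<Rightarrow> real ^ 'n ^ 'n \<Rightarrow> real" where
  "RE_objective A B = (\<Sum>i\<in>UNIV. \<Sum>j\<in>UNIV. B $ i $ j * ln (A $ i $ j / B $ i $ j))"

definition R_E :: "real ^ 'n ^ 'n \<Rightarrow> real" where
  "R_E A = (SUP B\<in>doubly_stochastic. RE_objective A B)"

text \<open>\<open>SUP\<close> and \<open>INF\<close> on the reals are meaningful only for nonempty sets that are bounded
  on the relevant side. The following facts show that this is the case throughout.\<close>

lemma doubly_stochastic_nonempty: "(doubly_stochastic :: (real ^ 'n ^ 'n) set) \<noteq> {}"
proof -
  have "(mat 1 :: real ^ 'n ^ 'n) \<in> doubly_stochastic"
    by (auto simp: doubly_stochastic_def mat_def)
  then show ?thesis by blast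
qed

lemma one_in_positive_matrices: "(\<chi> i j. 1) \<in> positive_matrices"
  by (simp add: positive_matrices_def)

lemma doubly_stochastic_entry_le_1:
  assumes "B \<in> doubly_stochastic"
  shows "B $ i $ j \<le> 1"
proof -
  have "B $ i $ j \<le> (\<Sum>j\<in>UNIV. B $ i $ j)"
    using assms by (intro member_le_sum) (auto simp: doubly_stochastic_def)
  then show ?thesis
    using assms by (simp add: doubly_stochastic_def)
qed

lemma self_power_bounds:
  assumes "0 \<le> b" "b \<le> 1"
  shows "0 \<le> self_power b" "self_power b \<le> 1"
  using assms powr_le1[of b b] by (auto simp: self_power_def)

lemma row_poly_nonneg:
  assumes "C \<in> positive_matrices" "x \<in> positive_matrices"
  shows "0 \<le> row_poly C x"
  using assms unfolding row_poly_def positive_matrices_def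
  by (intro prod_nonneg sum_nonneg mult_nonneg_nonneg) (auto simp: less_imp_le)

lemma col_poly_nonneg:
  assumes "D \<in> positive_matrices" "y \<in> positive_matrices"
  shows "0 \<le> col_poly D y"
  using assms unfolding col_poly_def positive_matrices_def
  by (intro prod_nonneg sum_nonneg mult_nonneg_nonneg) (auto simp: less_imp_le)

lemma RP_objective_nonneg:
  assumes "C \<in> positive_matrices" "D \<in> positive_matrices" "B \<in> doubly_stochastic"
    and "x \<in> positive_matrices" "y \<in> positive_matrices"
  shows "0 \<le> RP_objective C D B x y"
proof -
  have "0 \<le> row_poly C x" "0 \<le> col_poly D y"
    by (auto intro: assms row_poly_nonneg col_poly_nonneg)
  moreover have "0 \<le> (\<Prod>i\<in>UNIV. \<Prod>j\<in>UNIV. self_power (B $ i $ j))"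
    by (intro prod_nonneg) (auto simp: self_power_def)
  ultimately show ?thesis
    by (auto simp: RP_objective_def intro!: divide_nonneg_nonneg mult_nonneg_nonneg prod_nonneg)
qed

lemma RP_objective_bdd_below:
  assumes "C \<in> positive_matrices" "D \<in> positive_matrices" "B \<in> doubly_stochastic"
  shows "bdd_below ((\<lambda>(x, y). RP_objective C D B x y) ` (positive_matrices \<times> positive_matrices))"
  using assms by (intro bdd_belowI[of _ 0]) (auto intro: RP_objective_nonneg)

lemma RP_inner_bdd_above:
  assumes "C \<in> positive_matrices" "D \<in> positive_matrices"
  shows "bdd_above ((\<lambda>B. INF (x, y)\<in>positive_matrices \<times> positive_matrices.
           RP_objective C D B x y) ` doubly_stochastic)"
proof (intro bdd_aboveI2)
  fix B :: "real ^ 'a ^ 'a"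
  assume B: "B \<in> doubly_stochastic"
  let ?o = "(\<chi> i j. 1) :: real ^ 'a ^ 'a"
  have pc: "0 \<le> row_poly C ?o * col_poly D ?o"
    by (auto intro!: assms mult_nonneg_nonneg row_poly_nonneg col_poly_nonneg one_in_positive_matrices)
  have entry: "0 \<le> self_power (B $ i $ j)" "self_power (B $ i $ j) \<le> 1" for i j
    using B doubly_stochastic_entry_le_1[OF B] self_power_bounds
    by (auto simp: doubly_stochastic_def)
  have sp: "(\<Prod>i\<in>UNIV. \<Prod>j\<in>UNIV. self_power (B $ i $ j)) \<le> 1"
    by (intro prod_le_1 conjI prod_nonneg ballI entry)
  have "(INF (x, y)\<in>positive_matrices \<times> positive_matrices. RP_objective C D B x y)
          \<le> (case (?o, ?o) of (x, y) \<Rightarrow> RP_objective C D B x y)"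
    by (intro cINF_lower RP_objective_bdd_below assms B) (simp add: one_in_positive_matrices)
  also have "\<dots> = row_poly C ?o * col_poly D ?o *
                     (\<Prod>i\<in>UNIV. \<Prod>j\<in>UNIV. self_power (B $ i $ j))"
    by (simp add: RP_objective_def)
  also have "\<dots> \<le> row_poly C ?o * col_poly D ?o"
    using mult_left_mono[OF sp pc] by simp
  finally show "(INF (x, y)\<in>positive_matrices \<times> positive_matrices. RP_objective C D B x y)
                  \<le> row_poly C ?o * col_poly D ?o" .
qed

lemma RE_objective_bdd_above:
  assumes "A \<in> positive_matrices"
  shows "bdd_above (RE_objective A ` doubly_stochastic)"
proof (intro bdd_aboveI2)
  fix B :: "real ^ 'a ^ 'a"
  assume B: "B \<in> doubly_stochastic"
  have "B $ i $ j * ln (A $ i $ j / B $ i $ j) \<le> A $ i $ j" for i j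
  proof (cases "B $ i $ j = 0")
    case True
    then show ?thesis
      using assms by (simp add: positive_matrices_def less_imp_le)
  next
    case False
    then have pos: "B $ i $ j > 0" "A $ i $ j > 0"
      using B assms by (auto simp: doubly_stochastic_def positive_matrices_def less_le)
    then have "ln (A $ i $ j / B $ i $ j) \<le> A $ i $ j / B $ i $ j"
      using ln_bound[of "A $ i $ j / B $ i $ j"] by simp
    then have "B $ i $ j * ln (A $ i $ j / B $ i $ j) \<le> B $ i $ j * (A $ i $ j / B $ i $ j)"
      using pos by (intro mult_left_mono) auto
    then show ?thesis
      using pos by simp
  qed
  then show "RE_objective A B \<le> (\<Sum>i\<in>UNIV. \<Sum>j\<in>UNIV. A $ i $ j)"
    unfolding RE_objective_def by (intro sum_mono)
qed

end

(* For fixed B the inner infimum separates over the rows for x and over the columns for y.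
   Gibbs' inequality (weighted AM-GM) bounds each factor from below, with equality at
   x = B / C and y = B / D; since B may have zero entries, this minimiser is in general only
   a limit of positive matrices. So the inner infimum is exp of the entropy objective at B,
   and exp commutes with the outer supremum. *)

theory Submission
  imports Defs
begin

text \<open>Gibbs' inequality with unnormalised \<open>z\<close>. With \<open>S\<close> the sum of
  \<open>z\<close>, apply \<open>ln t \<le> t - 1\<close> at \<open>t = z i / (b i * S)\<close> and
  weight by \<open>b i\<close>; the bounds \<open>z i / S - b i\<close> sum to
  \<open>1 - 1 = 0\<close>. An index with \<open>b i = 0\<close> only needs
  \<open>0 \<le> z i / S\<close>.\<close>

lemma sum_mult_ln_div_le_ln_sum:
  fixes b z :: "'a \<Rightarrow> real"
  assumes "finite I" and b: "\<And>i. i \<in> I \<Longrightarrow> b i \<ge> 0" "sum b I = 1"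
    and z: "\<And>i. i \<in> I \<Longrightarrow> z i > 0"
  shows "(\<Sum>i\<in>I. b i * ln (z i / b i)) \<le> ln (sum z I)"
proof -
  define S where "S = sum z I"
  have "I \<noteq> {}"
    using b(2) by auto
  then have S: "S > 0"
    unfolding S_def using assms by (intro sum_pos) auto
  have "b i * ln (z i / b i) - b i * ln S \<le> z i / S - b i" if "i \<in> I" for i
  proof (cases "b i = 0")
    case True
    then show ?thesis
      using z[OF that] S by simp
  next
    case False
    then have pos: "b i > 0" "z i > 0"
      using b(1)[OF that] z[OF that] by auto
    have "b i * ln (z i / b i) - b i * ln S = b i * ln (z i / b i / S)"
      using pos S by (simp add: ln_div ln_mult algebra_simps)
    also have "\<dots> \<le> b i * (z i / b i / S - 1)"
      using pos S by (intro mult_left_mono ln_le_minus_one) auto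
    also have "\<dots> = z i / S - b i"
      using pos S by (simp add: field_simps)
    finally show ?thesis .
  qed
  then have "(\<Sum>i\<in>I. b i * ln (z i / b i) - b i * ln S) \<le> (\<Sum>i\<in>I. z i / S - b i)"
    by (rule sum_mono)
  also have "\<dots> = 0"
    using S b(2) by (simp add: sum_subtractf S_def flip: sum_divide_distrib)
  finally show ?thesis
    using b(2) by (simp add: sum_subtractf S_def flip: sum_distrib_right)
qed

lemma self_power_eq_exp: "b \<ge> 0 \<Longrightarrow> self_power b = exp (b * ln b)"
  by (simp add: self_power_def powr_def)

text \<open>Each row of \<open>B\<close> is a probability vector, so Gibbs' inequality applies row
  by row; exponentiating turns the sum over rows into the product that defines
  \<open>row_poly\<close>.\<close>

lemma row_poly_ge_exp:
  assumes C: "C \<in> positive_matrices" and x: "x \<in> positive_matrices"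
    and B: "B \<in> doubly_stochastic"
  shows "exp (\<Sum>i\<in>UNIV. \<Sum>j\<in>UNIV. B $ i $ j * ln (x $ i $ j * C $ i $ j / B $ i $ j))
           \<le> row_poly C x"
  unfolding row_poly_def
proof (subst exp_sum, simp, intro prod_mono conjI)
  fix i
  have pos: "x $ i $ j * C $ i $ j > 0" for j
    using C x by (simp add: positive_matrices_def)
  show "exp (\<Sum>j\<in>UNIV. B $ i $ j * ln (x $ i $ j * C $ i $ j / B $ i $ j))
          \<le> (\<Sum>j\<in>UNIV. x $ i $ j * C $ i $ j)"
    using sum_mult_ln_div_le_ln_sum[of UNIV "\<lambda>j. B $ i $ j" "\<lambda>j. x $ i $ j * C $ i $ j"] B pos
    by (subst ln_ge_iff[symmetric]) (auto simp: doubly_stochastic_def intro!: sum_pos)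
qed simp

lemma transpose_in_positive_matrices: "M \<in> positive_matrices \<Longrightarrow> transpose M \<in> positive_matrices"
  by (simp add: positive_matrices_def transpose_def)

lemma transpose_in_doubly_stochastic: "B \<in> doubly_stochastic \<Longrightarrow> transpose B \<in> doubly_stochastic"
  by (simp add: doubly_stochastic_def transpose_def)

text \<open>Reduces every fact about columns to its row version: transposition keeps both positivity
  and double stochasticity.\<close>

lemma col_poly_eq_row_poly_transpose: "col_poly D y = row_poly (transpose D) (transpose y)"
  by (simp add: col_poly_def row_poly_def transpose_def)

lemma col_poly_ge_exp:
  assumes "D \<in> positive_matrices" "y \<in> positive_matrices" "B \<in> doubly_stochastic"
  shows "exp (\<Sum>i\<in>UNIV. \<Sum>j\<in>UNIV. B $ i $ j * ln (y $ i $ j * D $ i $ j / B $ i $ j))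
           \<le> col_poly D y"
\<comment> \<open>The inner sum must run down a column to match a row of the transposed
  matrices.\<close>
proof (subst sum.swap)
  show "exp (\<Sum>j\<in>UNIV. \<Sum>i\<in>UNIV. B $ i $ j * ln (y $ i $ j * D $ i $ j / B $ i $ j))
          \<le> col_poly D y"
    using row_poly_ge_exp[of "transpose D" "transpose y" "transpose B"] assms
    by (simp add: col_poly_eq_row_poly_transpose transpose_in_positive_matrices
        transpose_in_doubly_stochastic) (simp add: transpose_def)
qed

text \<open>Isolates the dependence on \<open>x\<close> and \<open>y\<close> in two separate
  quotients, each at least 1 by Gibbs' inequality. What remains for the infimum is to bring both
  quotients arbitrarily close to 1.\<close>

lemma RP_objective_eq:
  assumes C: "C \<in> positive_matrices" and D: "D \<in> positive_matrices"
    and B: "B \<in> doubly_stochastic"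
    and x: "x \<in> positive_matrices" and y: "y \<in> positive_matrices"
  shows "RP_objective C D B x y =
           exp (RE_objective (entrywise_product C D) B)
           * (row_poly C x
              / exp (\<Sum>i\<in>UNIV. \<Sum>j\<in>UNIV. B $ i $ j * ln (x $ i $ j * C $ i $ j / B $ i $ j)))
           * (col_poly D y
              / exp (\<Sum>i\<in>UNIV. \<Sum>j\<in>UNIV. B $ i $ j * ln (y $ i $ j * D $ i $ j / B $ i $ j)))"
proof -
  let ?b = "\<lambda>i j. B $ i $ j" and ?c = "\<lambda>i j. C $ i $ j" and ?d = "\<lambda>i j. D $ i $ j"
    and ?x = "\<lambda>i j. x $ i $ j" and ?y = "\<lambda>i j. y $ i $ j"
  have b: "?b i j \<ge> 0" for i j
    using B by (simp add: doubly_stochastic_def)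
  have pos: "?c i j > 0" "?d i j > 0" "?x i j > 0" "?y i j > 0" for i j
    using C D x y by (auto simp: positive_matrices_def)
  have ne: "?c i j \<noteq> 0" "?d i j \<noteq> 0" "?x i j \<noteq> 0" "?y i j \<noteq> 0" for i j
    using pos[of i j] by auto
  have "(\<Sum>i\<in>UNIV. \<Sum>j\<in>UNIV. ?b i j * ln (?b i j))
        - (\<Sum>i\<in>UNIV. \<Sum>j\<in>UNIV. ?b i j * ln (?x i j * ?y i j))
      = (\<Sum>i\<in>UNIV. \<Sum>j\<in>UNIV. ?b i j * ln (?c i j * ?d i j / ?b i j))
        - (\<Sum>i\<in>UNIV. \<Sum>j\<in>UNIV. ?b i j * ln (?x i j * ?c i j / ?b i j))
        - (\<Sum>i\<in>UNIV. \<Sum>j\<in>UNIV. ?b i j * ln (?y i j * ?d i j / ?b i j))"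
    unfolding sum_subtractf[symmetric]
  proof (intro sum.cong refl)
    fix i j
    show "?b i j * ln (?b i j) - ?b i j * ln (?x i j * ?y i j)
        = ?b i j * ln (?c i j * ?d i j / ?b i j) - ?b i j * ln (?x i j * ?c i j / ?b i j)
          - ?b i j * ln (?y i j * ?d i j / ?b i j)"
      \<comment> \<open>A zero weight kills every term; otherwise all logarithms split, and those of
        the entries of \<open>C\<close> and \<open>D\<close> cancel.\<close>
      by (cases "?b i j = 0") (simp_all add: ne ln_mult ln_div algebra_simps)
  qed
  then have ratio: "exp (\<Sum>i\<in>UNIV. \<Sum>j\<in>UNIV. ?b i j * ln (?b i j))
        / exp (\<Sum>i\<in>UNIV. \<Sum>j\<in>UNIV. ?b i j * ln (?x i j * ?y i j))
      = exp (\<Sum>i\<in>UNIV. \<Sum>j\<in>UNIV. ?b i j * ln (?c i j * ?d i j / ?b i j))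
        / exp (\<Sum>i\<in>UNIV. \<Sum>j\<in>UNIV. ?b i j * ln (?x i j * ?c i j / ?b i j))
        / exp (\<Sum>i\<in>UNIV. \<Sum>j\<in>UNIV. ?b i j * ln (?y i j * ?d i j / ?b i j))"
    by (simp only: exp_diff[symmetric])
  have selfs: "(\<Prod>i\<in>UNIV. \<Prod>j\<in>UNIV. self_power (?b i j))
      = exp (\<Sum>i\<in>UNIV. \<Sum>j\<in>UNIV. ?b i j * ln (?b i j))"
    by (simp add: exp_sum self_power_eq_exp b)
  have powrs: "(\<Prod>i\<in>UNIV. \<Prod>j\<in>UNIV. (?x i j * ?y i j) powr ?b i j)
      = exp (\<Sum>i\<in>UNIV. \<Sum>j\<in>UNIV. ?b i j * ln (?x i j * ?y i j))"
    by (simp add: exp_sum powr_def ne)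
  have "RP_objective C D B x y = row_poly C x * col_poly D y
      * (exp (\<Sum>i\<in>UNIV. \<Sum>j\<in>UNIV. ?b i j * ln (?b i j))
         / exp (\<Sum>i\<in>UNIV. \<Sum>j\<in>UNIV. ?b i j * ln (?x i j * ?y i j)))"
    by (simp only: RP_objective_def selfs powrs times_divide_eq_right)
  then show ?thesis
    unfolding ratio RE_objective_def entrywise_product_def
    by (simp only: vec_lambda_beta times_divide_eq_right times_divide_eq_left
        ac_simps divide_divide_eq_left)
qed

text \<open>The minimiser \<open>x = B / C\<close>, with its zero entries replaced by \<open>e\<close> to keep it positive.\<close>

definition approx_minimiser :: "real ^ 'n ^ 'n \<Rightarrow> real ^ 'n ^ 'n \<Rightarrow> real \<Rightarrow> real ^ 'n ^ 'n" where
  "approx_minimiser C B e = (\<chi> i j. if B $ i $ j = 0 then e else B $ i $ j / C $ i $ j)"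

lemma approx_minimiser_positive:
  assumes "C \<in> positive_matrices" "B \<in> doubly_stochastic" "e > 0"
  shows "approx_minimiser C B e \<in> positive_matrices"
  using assms
  by (auto simp: approx_minimiser_def positive_matrices_def doubly_stochastic_def less_le)

text \<open>Where \<open>B\<close> vanishes the weight is 0, and elsewhere the logarithm is taken at
  1. Hence the exponentials dividing \<open>row_poly\<close> and \<open>col_poly\<close> in
  \<open>RP_objective_eq\<close> equal 1 for every \<open>e\<close>.\<close>

lemma approx_minimiser_entropy:
  assumes "C \<in> positive_matrices"
  shows "B $ i $ j * ln (approx_minimiser C B e $ i $ j * C $ i $ j / B $ i $ j) = 0"
proof -
  have "C $ i $ j \<noteq> 0"
    using assms by (auto simp: positive_matrices_def less_le)
  then show ?thesis
    by (simp add: approx_minimiser_def)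
qed

text \<open>After multiplication by \<open>C\<close> the entries are those of \<open>B\<close>,
  except that a zero becomes \<open>e\<close> times the entry of \<open>C\<close>. In the limit each
  factor of \<open>row_poly\<close> is a row sum of \<open>B\<close>, that is 1.\<close>

lemma tendsto_row_poly_approx_minimiser:
  assumes C: "C \<in> positive_matrices" and B: "B \<in> doubly_stochastic"
  shows "((\<lambda>e. row_poly C (approx_minimiser C B e)) \<longlongrightarrow> 1) (at_right 0)"
proof -
  have entry: "((\<lambda>e. approx_minimiser C B e $ i $ j * C $ i $ j) \<longlongrightarrow> B $ i $ j) (at_right 0)"
    for i j
  proof (cases "B $ i $ j = 0")
    case True
    then show ?thesis
      by (auto simp: approx_minimiser_def intro!: tendsto_eq_intros)
  next
    case False
    have "C $ i $ j \<noteq> 0"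
      using C by (auto simp: positive_matrices_def less_le)
    with False show ?thesis
      by (simp add: approx_minimiser_def)
  qed
  have "((\<lambda>e. row_poly C (approx_minimiser C B e)) \<longlongrightarrow> (\<Prod>i\<in>UNIV. \<Sum>j\<in>UNIV. B $ i $ j))
      (at_right 0)"
    unfolding row_poly_def by (intro tendsto_prod tendsto_sum entry)
  then show ?thesis
    using B by (simp add: doubly_stochastic_def)
qed

lemma tendsto_col_poly_approx_minimiser:
  assumes "D \<in> positive_matrices" "B \<in> doubly_stochastic"
  shows "((\<lambda>e. col_poly D (approx_minimiser D B e)) \<longlongrightarrow> 1) (at_right 0)"
proof -
  have "transpose (approx_minimiser D B e) = approx_minimiser (transpose D) (transpose B) e" for e
    by (simp add: approx_minimiser_def transpose_def vec_eq_iff)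
  then show ?thesis
    using tendsto_row_poly_approx_minimiser[of "transpose D" "transpose B"] assms
    by (simp add: col_poly_eq_row_poly_transpose transpose_in_positive_matrices
        transpose_in_doubly_stochastic)
qed

lemma INF_RP_objective:
  assumes C: "C \<in> positive_matrices" and D: "D \<in> positive_matrices"
    and B: "B \<in> doubly_stochastic"
  shows "(INF (x, y)\<in>positive_matrices \<times> positive_matrices. RP_objective C D B x y)
           = exp (RE_objective (entrywise_product C D) B)"
    (is "?inf = ?E")
proof (rule antisym)
  let ?x = "approx_minimiser C B" and ?y = "approx_minimiser D B"
  have le: "?inf \<le> ?E * row_poly C (?x e) * col_poly D (?y e)" if "e > 0" for e
  proof -
    have mem: "?x e \<in> positive_matrices" "?y e \<in> positive_matrices"
      using C D B that by (auto intro: approx_minimiser_positive)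
    then have "?inf \<le> (case (?x e, ?y e) of (x, y) \<Rightarrow> RP_objective C D B x y)"
      by (intro cINF_lower RP_objective_bdd_below C D B) simp
    also have "\<dots> = ?E * row_poly C (?x e) * col_poly D (?y e)"
      using RP_objective_eq[OF C D B mem]
      by (simp add: approx_minimiser_entropy[OF C] approx_minimiser_entropy[OF D]
          del: mult_eq_0_iff)
    finally show ?thesis .
  qed
  have "((\<lambda>e. ?E * row_poly C (?x e) * col_poly D (?y e)) \<longlongrightarrow> ?E * 1 * 1) (at_right 0)"
    by (intro tendsto_intros tendsto_row_poly_approx_minimiser
        tendsto_col_poly_approx_minimiser C D B)
  \<comment> \<open>The infimum does not depend on \<open>e\<close>, so the bound \<open>le\<close>
    passes to the limit; \<open>at_right 0\<close> only involves \<open>e > 0\<close>, where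
    \<open>le\<close> holds.\<close>
  then have "?inf \<le> ?E * 1 * 1"
    by (rule tendsto_lowerbound) (auto simp: eventually_at_filter le)
  then show "?inf \<le> ?E"
    by simp
next
  show "?E \<le> ?inf"
  proof (rule cINF_greatest)
    show "positive_matrices \<times> positive_matrices \<noteq> ({} :: ((real ^ 'a ^ 'a) \<times> (real ^ 'a ^ 'a)) set)"
      using one_in_positive_matrices by blast
  next
    fix xy :: "(real ^ 'a ^ 'a) \<times> (real ^ 'a ^ 'a)"
    assume "xy \<in> positive_matrices \<times> positive_matrices"
    then obtain x y where xy: "xy = (x, y)" "x \<in> positive_matrices" "y \<in> positive_matrices"
      by auto
    let ?r = "row_poly C x
      / exp (\<Sum>i\<in>UNIV. \<Sum>j\<in>UNIV. B $ i $ j * ln (x $ i $ j * C $ i $ j / B $ i $ j))"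
    let ?s = "col_poly D y
      / exp (\<Sum>i\<in>UNIV. \<Sum>j\<in>UNIV. B $ i $ j * ln (y $ i $ j * D $ i $ j / B $ i $ j))"
    have "?r \<ge> 1" "?s \<ge> 1"
      using row_poly_ge_exp[OF C xy(2) B] col_poly_ge_exp[OF D xy(3) B] by simp_all
    \<comment> \<open>By \<open>RP_objective_eq\<close> the objective is
      \<open>?E * ?r * ?s\<close>, so \<open>?E\<close> is a lower bound once this product is at
      least 1.\<close>
    then have "1 * 1 \<le> ?r * ?s"
      by (intro mult_mono) linarith+
    then have "?E * 1 \<le> ?E * (?r * ?s)"
      by (intro mult_left_mono) auto
    then show "?E \<le> (case xy of (x, y) \<Rightarrow> RP_objective C D B x y)"
      using RP_objective_eq[OF C D B xy(2,3)] by (simp add: xy(1) mult.assoc)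
  qed
qed

lemma entrywise_product_positive:
  "C \<in> positive_matrices \<Longrightarrow> D \<in> positive_matrices \<Longrightarrow> entrywise_product C D \<in> positive_matrices"
  by (simp add: positive_matrices_def entrywise_product_def)

theorem theorem2:
  fixes C D :: "real ^ 'n ^ 'n"
  assumes "C \<in> positive_matrices" and "D \<in> positive_matrices"
  shows "R_P C D = exp (R_E (entrywise_product C D))"
proof -
  let ?f = "RE_objective (entrywise_product C D)"
  have "R_P C D = (SUP B\<in>doubly_stochastic. exp (?f B))"
    unfolding R_P_def by (intro SUP_cong refl INF_RP_objective assms)
  \<comment> \<open>A monotone function that is left-continuous at the supremum commutes with the
    supremum of a nonempty set bounded above.\<close>
  also have "\<dots> = exp (SUP B\<in>doubly_stochastic. ?f B)"
    using continuous_at_Sup_mono[of exp "?f ` doubly_stochastic"]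
      RE_objective_bdd_above[OF entrywise_product_positive[OF assms]]
    by (simp add: mono_def doubly_stochastic_nonempty image_image continuous_at_imp_continuous_within)
  finally show ?thesis
    by (simp add: R_E_def)
qed

end
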